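(* Let $G$ be a group that is surjunctive or dual surjunctive, and let $K$ be a field of positive characteristic. Then the group ring $K[G]$ is directly finite, i.e. for all $a,b\in K[G]$, $ab=1$ implies $ba=1$.
   Context: For a group $G$ and a finite set $A$, $A^G$ carries the product topology ($A$ discrete) and the action $(g\cdot f)(x)=f(g^{-1}x)$. A cellular automaton $T\colon A^G\to A^G$ is a continuous $G$-equivariant map. For $c,d\in A^G$ write $c\sim d$ if $\{g\in G: c(g)\neq d(g)\}$ is finite. $T$ is post-surjective if whenever $c,e\in A^G$ and $T(c)\sim e$, there is $c'\sim c$ with $T(c')=e$. $T$ is pre-injective if $c\sim d$ and $T(c)=T(d)$ imply $c=d$. A group $G$ is surjunctive if for every finite set $A$, every injective cellular automaton $T\colon A^G\to A^G$ is surjective. A group $G$ is dual surjunctive if for every finite set $A$, every post-surjective cellular automaton $T\colon A^G\to A^G$ is pre-injective. *)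

theory Defs
  imports "HOL-Analysis.Function_Topology" "HOL-Library.Poly_Mapping"
begin

text \<open>
  Groups are types of class \<^class>\<open>group_add\<close>. This class is not assumed to be commutative: the
  group law is merely written additively, so that \<open>g\<^sup>-\<^sup>1 x\<close> reads \<open>- g + x\<close>.
  The group ring \<open>K[G]\<close> is the type \<open>'g \<Rightarrow>\<^sub>0 'k\<close> of finitely supported functions, whose
  multiplication in \<^theory>\<open>HOL-Library.Poly_Mapping\<close> is the convolution product and whose unit
  is the indicator function of the neutral element.
\<close>

abbreviation full_shift :: "'a set \<Rightarrow> ('g::group_add \<Rightarrow> 'a) set" where
  "full_shift A \<equiv> UNIV \<rightarrow>\<^sub>E A"

definition shift_topology :: "'a set \<Rightarrow> ('g::group_add \<Rightarrow> 'a) topology" where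
  "shift_topology A = product_topology (\<lambda>_. discrete_topology A) UNIV"

lemma topspace_shift_topology [simp]: "topspace (shift_topology A) = full_shift A"
  by (simp add: shift_topology_def)

definition shift :: "'g::group_add \<Rightarrow> ('g \<Rightarrow> 'a) \<Rightarrow> 'g \<Rightarrow> 'a" where
  "shift g f = (\<lambda>x. f (- g + x))"

definition cellular_automaton ::
    "'a set \<Rightarrow> (('g::group_add \<Rightarrow> 'a) \<Rightarrow> ('g \<Rightarrow> 'a)) \<Rightarrow> bool" where
  "cellular_automaton A T \<longleftrightarrow>
     continuous_map (shift_topology A) (shift_topology A) T \<and>
     (\<forall>g. \<forall>c \<in> full_shift A. T (shift g c) = shift g (T c))"

definition asymptotic :: "('g \<Rightarrow> 'a) \<Rightarrow> ('g \<Rightarrow> 'a) \<Rightarrow> bool" (infix \<open>\<sim>\<^sub>f\<close> 50) where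
  "c \<sim>\<^sub>f d \<longleftrightarrow> finite {g. c g \<noteq> d g}"

definition post_surjective ::
    "'a set \<Rightarrow> (('g::group_add \<Rightarrow> 'a) \<Rightarrow> ('g \<Rightarrow> 'a)) \<Rightarrow> bool" where
  "post_surjective A T \<longleftrightarrow>
     (\<forall>c \<in> full_shift A. \<forall>e \<in> full_shift A. T c \<sim>\<^sub>f e \<longrightarrow>
        (\<exists>c' \<in> full_shift A. c' \<sim>\<^sub>f c \<and> T c' = e))"

definition pre_injective ::
    "'a set \<Rightarrow> (('g::group_add \<Rightarrow> 'a) \<Rightarrow> ('g \<Rightarrow> 'a)) \<Rightarrow> bool" where
  "pre_injective A T \<longleftrightarrow>
     (\<forall>c \<in> full_shift A. \<forall>d \<in> full_shift A. c \<sim>\<^sub>f d \<and> T c = T d \<longrightarrow> c = d)"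

text \<open>
  A definition cannot quantify over types, so the alphabets range over the finite sets of natural
  numbers. Every finite set is in bijection with one of these; the lemmas \<open>surjunctiveD\<close> and
  \<open>dual_surjunctiveD\<close> below give the corresponding properties for finite alphabets of any type.
\<close>

definition surjunctive :: "'g::group_add itself \<Rightarrow> bool" where
  "surjunctive _ \<longleftrightarrow>
     (\<forall>A :: nat set. finite A \<longrightarrow>
        (\<forall>T :: ('g \<Rightarrow> nat) \<Rightarrow> ('g \<Rightarrow> nat).
           cellular_automaton A T \<and> inj_on T (full_shift A) \<longrightarrow>
           T ` full_shift A = full_shift A))"

definition dual_surjunctive :: "'g::group_add itself \<Rightarrow> bool" where
  "dual_surjunctive _ \<longleftrightarrow>
     (\<forall>A :: nat set. finite A \<longrightarrow>
        (\<forall>T :: ('g \<Rightarrow> nat) \<Rightarrow> ('g \<Rightarrow> nat).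
           cellular_automaton A T \<and> post_surjective A T \<longrightarrow> pre_injective A T))"

text \<open>Change of alphabet along mutually inverse bijections \<open>h\<close> and \<open>k\<close>.\<close>

definition recode ::
    "('a \<Rightarrow> 'b) \<Rightarrow> ('b \<Rightarrow> 'a) \<Rightarrow> (('g \<Rightarrow> 'a) \<Rightarrow> ('g \<Rightarrow> 'a)) \<Rightarrow> ('g \<Rightarrow> 'b) \<Rightarrow> 'g \<Rightarrow> 'b" where
  "recode h k T = (\<lambda>c. h \<circ> T (k \<circ> c))"

lemma continuous_map_recode:
  assumes "h \<in> A \<rightarrow> B"
  shows "continuous_map (shift_topology A) (shift_topology B) (\<lambda>c. h \<circ> c)"
proof -
  have "continuous_map (shift_topology A) (discrete_topology B) (\<lambda>c. h (c i))" for i :: 'c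
  proof -
    have "continuous_map (shift_topology A) (discrete_topology A) (\<lambda>c. c i)"
      unfolding shift_topology_def by (rule continuous_map_product_projection) simp
    moreover have "continuous_map (discrete_topology A) (discrete_topology B) h"
      using assms by simp
    ultimately show ?thesis
      using continuous_map_compose[of _ _ "\<lambda>c. c i" _ h] by (simp add: o_def)
  qed
  then show ?thesis
    unfolding shift_topology_def[of B]
    by (auto simp: continuous_map_componentwise o_def)
qed

lemma cellular_automaton_closed:
  "cellular_automaton A T \<Longrightarrow> c \<in> full_shift A \<Longrightarrow> T c \<in> full_shift A"
  using continuous_map_image_subset_topspace[of "shift_topology A" "shift_topology A" T]
  by (simp add: cellular_automaton_def image_subset_iff)

lemma comp_full_shift: "h \<in> A \<rightarrow> B \<Longrightarrow> c \<in> full_shift A \<Longrightarrow> h \<circ> c \<in> full_shift B"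
  by (auto simp: PiE_iff)

lemma cellular_automaton_recode:
  assumes "cellular_automaton A T" "h \<in> A \<rightarrow> B" "k \<in> B \<rightarrow> A"
  shows "cellular_automaton B (recode h k T)"
proof -
  have "continuous_map (shift_topology B) (shift_topology B) ((\<lambda>c. h \<circ> c) \<circ> (T \<circ> (\<lambda>c. k \<circ> c)))"
    using assms by (intro continuous_map_compose[where X' = "shift_topology A"] continuous_map_recode)
      (auto simp: cellular_automaton_def)
  moreover have "recode h k T (shift g c) = shift g (recode h k T c)" if "c \<in> full_shift B" for g c
  proof -
    have "k \<circ> c \<in> full_shift A" using comp_full_shift[OF assms(3) that] .
    then have "T (shift g (k \<circ> c)) = shift g (T (k \<circ> c))"
      using assms(1) unfolding cellular_automaton_def by blast
    then show ?thesis by (simp add: recode_def shift_def o_def)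
  qed
  ultimately show ?thesis
    by (simp add: cellular_automaton_def recode_def o_def)
qed

lemma comp_inverse_full_shift:
  "\<forall>a\<in>A. k (h a) = a \<Longrightarrow> c \<in> full_shift A \<Longrightarrow> k \<circ> (h \<circ> c) = c"
  by (auto simp: fun_eq_iff PiE_iff)

lemma asymptotic_comp: "c \<sim>\<^sub>f d \<Longrightarrow> (h \<circ> c) \<sim>\<^sub>f (h \<circ> d)"
  unfolding asymptotic_def by (erule rev_finite_subset) auto

lemma obtain_nat_alphabet:
  assumes "finite (A :: 'a set)"
  obtains B :: "nat set" and h k where "finite B" "h \<in> A \<rightarrow> B" "k \<in> B \<rightarrow> A"
    "\<forall>a\<in>A. k (h a) = a" "\<forall>b\<in>B. h (k b) = b"
proof -
  obtain h where h: "bij_betw h A {0..<card A}"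
    using ex_bij_betw_finite_nat[OF assms] by blast
  show ?thesis
  proof (rule that[of "{0..<card A}" h "inv_into A h"])
    show "h \<in> A \<rightarrow> {0..<card A}" using h by (auto simp: bij_betw_def)
    show "inv_into A h \<in> {0..<card A} \<rightarrow> A"
      using bij_betw_inv_into[OF h] by (auto simp: bij_betw_def)
    show "\<forall>a\<in>A. inv_into A h (h a) = a"
      using bij_betw_inv_into_left[OF h] by blast
    show "\<forall>b\<in>{0..<card A}. h (inv_into A h b) = b"
      using bij_betw_inv_into_right[OF h] by blast
  qed simp
qed

lemma surjunctiveD:
  fixes T :: "('g::group_add \<Rightarrow> 'a) \<Rightarrow> ('g \<Rightarrow> 'a)"
  assumes S: "surjunctive TYPE('g)" and A: "finite A"
    and T: "cellular_automaton A T" and inj: "inj_on T (full_shift A)"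
  shows "T ` full_shift A = full_shift A"
proof -
  obtain B :: "nat set" and h k where B: "finite B" and h: "h \<in> A \<rightarrow> B" and k: "k \<in> B \<rightarrow> A"
    and kh: "\<forall>a\<in>A. k (h a) = a" and hk: "\<forall>b\<in>B. h (k b) = b"
    by (rule obtain_nat_alphabet[OF A])
  note cl = cellular_automaton_closed[OF T]
  note fA = comp_full_shift[OF k] and fB = comp_full_shift[OF h]
  note ikh = comp_inverse_full_shift[of A k h, OF kh]
    and ihk = comp_inverse_full_shift[of B h k, OF hk]
  have "inj_on (recode h k T) (full_shift B)"
  proof (rule inj_onI)
    fix c d assume c: "c \<in> full_shift B" and d: "d \<in> full_shift B"
      and e: "recode h k T c = recode h k T d"
    have "k \<circ> (h \<circ> T (k \<circ> c)) = k \<circ> (h \<circ> T (k \<circ> d))" using e by (simp add: recode_def)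
    then have "T (k \<circ> c) = T (k \<circ> d)"
      by (simp only: ikh[OF cl[OF fA[OF c]]] ikh[OF cl[OF fA[OF d]]])
    then have "k \<circ> c = k \<circ> d" using inj_onD[OF inj] fA c d by blast
    then have "h \<circ> (k \<circ> c) = h \<circ> (k \<circ> d)" by (rule arg_cong)
    then show "c = d" by (simp only: ihk[OF c] ihk[OF d])
  qed
  then have sur: "recode h k T ` full_shift B = full_shift B"
    by (intro S[unfolded surjunctive_def, rule_format, OF B] conjI cellular_automaton_recode[OF T h k])
  have "e \<in> T ` full_shift A" if e: "e \<in> full_shift A" for e
  proof -
    have "h \<circ> e \<in> recode h k T ` full_shift B" using sur fB[OF e] by simp
    then obtain c where c: "c \<in> full_shift B" "h \<circ> e = h \<circ> T (k \<circ> c)"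
      unfolding recode_def by (rule imageE)
    from c(2) have "k \<circ> (h \<circ> e) = k \<circ> (h \<circ> T (k \<circ> c))" by (rule arg_cong)
    then have "e = T (k \<circ> c)" by (simp only: ikh[OF e] ikh[OF cl[OF fA[OF c(1)]]])
    then show ?thesis using fA c(1) by blast
  qed
  then show ?thesis by (intro subset_antisym image_subsetI cl subsetI)
qed

lemma dual_surjunctiveD:
  fixes T :: "('g::group_add \<Rightarrow> 'a) \<Rightarrow> ('g \<Rightarrow> 'a)"
  assumes S: "dual_surjunctive TYPE('g)" and A: "finite A"
    and T: "cellular_automaton A T" and post: "post_surjective A T"
  shows "pre_injective A T"
proof -
  obtain B :: "nat set" and h k where B: "finite B" and h: "h \<in> A \<rightarrow> B" and k: "k \<in> B \<rightarrow> A"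
    and kh: "\<forall>a\<in>A. k (h a) = a" and hk: "\<forall>b\<in>B. h (k b) = b"
    by (rule obtain_nat_alphabet[OF A])
  note cl = cellular_automaton_closed[OF T]
  note fA = comp_full_shift[OF k] and fB = comp_full_shift[OF h]
  note ikh = comp_inverse_full_shift[of A k h, OF kh]
    and ihk = comp_inverse_full_shift[of B h k, OF hk]
  have "post_surjective B (recode h k T)"
    unfolding post_surjective_def
  proof (intro ballI impI)
    fix c e assume c: "c \<in> full_shift B" and e: "e \<in> full_shift B"
      and ae: "recode h k T c \<sim>\<^sub>f e"
    have "T (k \<circ> c) \<sim>\<^sub>f k \<circ> e"
      using asymptotic_comp[OF ae, of k] by (simp only: recode_def ikh[OF cl[OF fA[OF c]]])
    then obtain c' where c': "c' \<in> full_shift A" "c' \<sim>\<^sub>f k \<circ> c" "T c' = k \<circ> e"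
      using post[unfolded post_surjective_def, rule_format, OF fA[OF c] fA[OF e]] by blast
    from c'(1) have "h \<circ> c' \<in> full_shift B" by (rule fB)
    moreover have "h \<circ> c' \<sim>\<^sub>f c" using asymptotic_comp[OF c'(2), of h] by (simp only: ihk[OF c])
    moreover have "recode h k T (h \<circ> c') = e"
      by (simp only: recode_def ikh[OF c'(1)] c'(3) ihk[OF e])
    ultimately show "\<exists>c' \<in> full_shift B. c' \<sim>\<^sub>f c \<and> recode h k T c' = e"
      by blast
  qed
  then have pre: "pre_injective B (recode h k T)"
    by (intro S[unfolded dual_surjunctive_def, rule_format, OF B] conjI cellular_automaton_recode[OF T h k])
  show ?thesis
    unfolding pre_injective_def
  proof (intro ballI impI, elim conjE)
    fix c d assume c: "c \<in> full_shift A" and d: "d \<in> full_shift A"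
      and cd: "c \<sim>\<^sub>f d" and e: "T c = T d"
    have "recode h k T (h \<circ> c) = recode h k T (h \<circ> d)"
      by (simp only: recode_def ikh[OF c] ikh[OF d] e)
    then have "h \<circ> c = h \<circ> d"
      by (intro pre[unfolded pre_injective_def, rule_format, OF fB[OF c] fB[OF d]] conjI
          asymptotic_comp[OF cd])
    then have "k \<circ> (h \<circ> c) = k \<circ> (h \<circ> d)" by (rule arg_cong)
    then show "c = d" by (simp only: ikh[OF c] ikh[OF d])
  qed
qed

end

theory Submission
  imports Defs "HOL-Algebra.Algebraic_Closure_Type"
begin

text \<open>
  Over a finite ring \<open>A\<close> the claim is a statement about automata. An element \<open>a\<close> of \<open>A[G]\<close> acts on
  configurations \<open>c : G \<Rightarrow> A\<close> by \<open>(T\<^sub>a c)(x) = \<Sum>\<^sub>g a(g) c(xg)\<close>. This sum reads finitely many cells and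
  uses only right translations, so \<open>T\<^sub>a\<close> is a cellular automaton with finite alphabet \<open>A\<close>, and
  \<open>T\<^sub>a \<circ> T\<^sub>b = T\<^bsub>ab\<^esub>\<close>. If \<open>ab = 1\<close>, then \<open>T\<^sub>b\<close> has the left inverse \<open>T\<^sub>a\<close> and is injective;
  in a surjunctive group it is therefore bijective, and \<open>T\<^sub>b \<circ> T\<^sub>a\<close> is the identity. Dually, \<open>T\<^sub>a\<close> is
  post-surjective, because the finite error \<open>e - T\<^sub>a c\<close> is repaired by adding the finitely supported
  \<open>T\<^sub>b (e - T\<^sub>a c)\<close> to \<open>c\<close>; in a dual surjunctive group \<open>T\<^sub>a\<close> is then pre-injective, and
  \<open>T\<^sub>a (T\<^sub>b (T\<^sub>a c)) = T\<^sub>a c\<close> gives \<open>T\<^sub>b (T\<^sub>a c) = c\<close> for finitely supported \<open>c\<close>. Either way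
  \<open>T\<^bsub>ba\<^esub>\<close> fixes all point masses, whose images carry the coefficients of \<open>ba\<close>, so \<open>ba = 1\<close>
  (\<open>directly_finite_over_finite_ring\<close>).

  The reduction to finite rings is a form of the Nullstellensatz. The coefficients of \<open>a\<close> and \<open>b\<close>
  generate a subring \<open>S\<close> of \<open>K\<close>, and if \<open>ba \<noteq> 1\<close> then some coefficient \<open>x\<close> of \<open>ba - 1\<close> is a nonzero
  element of \<open>S\<close>. It suffices to find a ring homomorphism \<open>\<phi>\<close> on \<open>S\<close> with finite image and
  \<open>\<phi> x \<noteq> 0\<close>, since applying \<open>\<phi>\<close> to all coefficients contradicts the finite case. Such a \<open>\<phi>\<close>, with
  values in the algebraic closure of \<open>K\<close>, is built by adjoining the generators one at a time to
  the prime subring, which is finite in positive characteristic. The inductive step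
  (\<open>nonvanishing_extension\<close>) replaces a nonzero \<open>x\<close> of \<open>S[t]\<close> by a nonzero \<open>y\<close> of \<open>S\<close> such that every
  \<open>\<phi>\<close> on \<open>S\<close> with \<open>\<phi> y \<noteq> 0\<close> extends to \<open>S[t]\<close> without killing \<open>x\<close>.
\<close>

section \<open>Subrings and polynomials over them\<close>

definition unital_subring :: "'r::ring_1 set \<Rightarrow> bool" where
  "unital_subring S \<longleftrightarrow>
     1 \<in> S \<and> (\<forall>x\<in>S. \<forall>y\<in>S. x - y \<in> S \<and> x * y \<in> S)"

lemma unital_subringD:
  assumes "unital_subring S"
  shows "0 \<in> S" "1 \<in> S" "x \<in> S \<Longrightarrow> - x \<in> S"
    "x \<in> S \<Longrightarrow> y \<in> S \<Longrightarrow> x + y \<in> S" "x \<in> S \<Longrightarrow> y \<in> S \<Longrightarrow> x - y \<in> S"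
    "x \<in> S \<Longrightarrow> y \<in> S \<Longrightarrow> x * y \<in> S"
proof -
  have d: "x - y \<in> S" if "x \<in> S" "y \<in> S" for x y
    using assms that unfolding unital_subring_def by blast
  show 1: "1 \<in> S" using assms unfolding unital_subring_def by blast
  show 0: "0 \<in> S" using d[OF 1 1] by simp
  have m: "- x \<in> S" if "x \<in> S" for x using d[OF 0 that] by simp
  show "x \<in> S \<Longrightarrow> - x \<in> S" by (rule m)
  show "x \<in> S \<Longrightarrow> y \<in> S \<Longrightarrow> x + y \<in> S" using d[OF _ m] by fastforce
  show "x \<in> S \<Longrightarrow> y \<in> S \<Longrightarrow> x - y \<in> S" by (rule d)
  show "x \<in> S \<Longrightarrow> y \<in> S \<Longrightarrow> x * y \<in> S" using assms unfolding unital_subring_def by blast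
qed

lemma unital_subring_sum:
  "unital_subring S \<Longrightarrow> (\<And>i. i \<in> I \<Longrightarrow> f i \<in> S) \<Longrightarrow> (\<Sum>i\<in>I. f i) \<in> S"
  by (induction I rule: infinite_finite_induct) (auto intro: unital_subringD)

lemma unital_subring_power: "unital_subring S \<Longrightarrow> x \<in> S \<Longrightarrow> x ^ n \<in> S"
  by (induction n) (auto intro: unital_subringD)

definition polys_over :: "'a::zero set \<Rightarrow> 'a poly set" where
  "polys_over S = {f. range (coeff f) \<subseteq> S}"

lemma coeff_polys_over: "f \<in> polys_over S \<Longrightarrow> coeff f i \<in> S"
  by (auto simp: polys_over_def)

lemma polys_over_closed:
  fixes S :: "'a::comm_ring_1 set"
  assumes "unital_subring S"
  shows "0 \<in> polys_over S"
    and "a \<in> S \<Longrightarrow> f \<in> polys_over S \<Longrightarrow> pCons a f \<in> polys_over S"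
    and "a \<in> S \<Longrightarrow> f \<in> polys_over S \<Longrightarrow> smult a f \<in> polys_over S"
    and "a \<in> S \<Longrightarrow> monom a n \<in> polys_over S"
    and "f \<in> polys_over S \<Longrightarrow> g \<in> polys_over S \<Longrightarrow> f + g \<in> polys_over S"
    and "f \<in> polys_over S \<Longrightarrow> g \<in> polys_over S \<Longrightarrow> f - g \<in> polys_over S"
    and "f \<in> polys_over S \<Longrightarrow> g \<in> polys_over S \<Longrightarrow> f * g \<in> polys_over S"
  using assms
  by (auto simp: polys_over_def coeff_pCons coeff_mult image_subset_iff
      intro!: unital_subringD unital_subring_sum split: nat.split)

text \<open>
  Division with remainder does not leave \<open>S\<close> if powers of the leading coefficient of the divisor are
  multiplied in instead of being inverted. Only such powers occur, so the multiplier survives every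
  homomorphism that does not kill the leading coefficient.
\<close>

lemma pseudo_division_over:
  fixes S :: "'a::idom set"
  assumes S: "unital_subring S" and g: "g \<in> polys_over S" "g \<noteq> 0" and f: "f \<in> polys_over S"
  obtains k q r where "q \<in> polys_over S" "r \<in> polys_over S"
    "smult (lead_coeff g ^ k) f = q * g + r" "r = 0 \<or> degree r < degree g"
proof -
  have "\<exists>k. \<exists>q\<in>polys_over S. \<exists>r\<in>polys_over S.
      smult (lead_coeff g ^ k) f = q * g + r \<and> (r = 0 \<or> degree r < degree g)"
    using f
  proof (induction "degree f" arbitrary: f rule: less_induct)
    case less
    note cl = polys_over_closed[OF S]
    show ?case
    proof (cases "degree f < degree g")
      case True
      then show ?thesis using less.prems cl(1)
        by (intro exI[of _ 0] bexI[of _ 0] bexI[of _ f]) auto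
    next
      case False
      \<comment> \<open>cancel the leading term of \<open>f\<close> after scaling \<open>f\<close> by the leading coefficient of \<open>g\<close>\<close>
      define m where "m = monom (lead_coeff f) (degree f - degree g)"
      define f' where "f' = smult (lead_coeff g) f - m * g"
      have m: "m \<in> polys_over S"
        unfolding m_def using less.prems by (intro cl(4) coeff_polys_over)
      have f'S: "f' \<in> polys_over S"
        unfolding f'_def using m g less.prems by (intro cl coeff_polys_over)
      have "degree (m * g) \<le> degree f"
        using False degree_mult_le[of m g] degree_monom_le[of "lead_coeff f" "degree f - degree g"]
        unfolding m_def by linarith
      then have "degree f' \<le> degree f"
        unfolding f'_def by (intro degree_diff_le degree_smult_le)
      moreover have "coeff f' (degree f) = 0"
        using False by (simp add: f'_def m_def coeff_monom_mult)
      ultimately consider "f' = 0" | "degree f' < degree f"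
        using eq_zero_or_degree_less by blast
      then show ?thesis
      proof cases
        case 1
        then show ?thesis using m cl(1) unfolding f'_def
          by (intro exI[of _ 1] bexI[of _ m] bexI[of _ 0]) auto
      next
        case 2
        obtain k q r where kqr: "q \<in> polys_over S" "r \<in> polys_over S"
          "smult (lead_coeff g ^ k) f' = q * g + r" "r = 0 \<or> degree r < degree g"
          using less.hyps[OF 2 f'S] by blast
        have "smult (lead_coeff g ^ Suc k) f
            = smult (lead_coeff g ^ k) f' + smult (lead_coeff g ^ k) m * g"
          by (simp add: f'_def smult_diff_right mult.commute)
        also have "\<dots> = (q + smult (lead_coeff g ^ k) m) * g + r"
          by (simp add: kqr(3) algebra_simps)
        finally show ?thesis
          using kqr m g S
          by (intro exI[of _ "Suc k"] bexI[of _ "q + smult (lead_coeff g ^ k) m"] bexI[of _ r])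
            (auto intro!: cl unital_subring_power coeff_polys_over)
      qed
    qed
  qed
  then show ?thesis using that by blast
qed

lemma finite_polys_over_degree_less:
  assumes "finite F"
  shows "finite {f \<in> polys_over F. f = 0 \<or> degree f < n}"
proof (rule finite_subset)
  show "{f \<in> polys_over F. f = 0 \<or> degree f < n} \<subseteq>
      Poly ` {xs. set xs \<subseteq> F \<and> length xs \<le> n}"
  proof
    fix f assume f: "f \<in> {f \<in> polys_over F. f = 0 \<or> degree f < n}"
    then have "set (coeffs f) \<subseteq> F" "length (coeffs f) \<le> n"
      by (auto simp: polys_over_def coeffs_def Let_def)
    then show "f \<in> Poly ` {xs. set xs \<subseteq> F \<and> length xs \<le> n}"
      by (intro image_eqI[of _ _ "coeffs f"]) auto
  qed
  show "finite (Poly ` {xs. set xs \<subseteq> F \<and> length xs \<le> n})"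
    using finite_lists_length_le[OF assms] by blast
qed

text \<open>
  Pseudo-division by \<open>p\<close> shows that every value at \<open>\<tau>\<close> is a quotient \<open>r(\<tau>) / c\<close> with \<open>c \<in> F\<close> and \<open>r\<close> one of
  the finitely many polynomials over \<open>F\<close> of degree below that of \<open>p\<close>.
\<close>

lemma finite_values_at_root:
  fixes F :: "'a::field set"
  assumes F: "unital_subring F" "finite F" and p: "p \<in> polys_over F" "p \<noteq> 0" "poly p \<tau> = 0"
  shows "finite ((\<lambda>f. poly f \<tau>) ` polys_over F)"
proof (rule finite_subset)
  let ?R = "{f \<in> polys_over F. f = 0 \<or> degree f < degree p}"
  show "finite ((\<lambda>(r, c). poly r \<tau> / c) ` (?R \<times> F))"
    using F finite_polys_over_degree_less by blast
  show "(\<lambda>f. poly f \<tau>) ` polys_over F \<subseteq> (\<lambda>(r, c). poly r \<tau> / c) ` (?R \<times> F)"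
  proof (rule image_subsetI)
    fix f assume "f \<in> polys_over F"
    then obtain k q r where kqr: "r \<in> polys_over F"
      "smult (lead_coeff p ^ k) f = q * p + r" "r = 0 \<or> degree r < degree p"
      using pseudo_division_over[OF F(1) p(1,2)] by metis
    define c where "c = lead_coeff p ^ k"
    have c: "c \<noteq> 0" "c \<in> F"
      using p F(1) by (auto simp: c_def intro!: unital_subring_power coeff_polys_over)
    have "c * poly f \<tau> = poly r \<tau>"
      using arg_cong[OF kqr(2), of "\<lambda>h. poly h \<tau>"] p(3) by (simp add: c_def)
    then have "poly f \<tau> = poly r \<tau> / c" using c by (simp add: field_simps)
    then show "poly f \<tau> \<in> (\<lambda>(r, c). poly r \<tau> / c) ` (?R \<times> F)"
      using kqr c by (intro image_eqI[of _ _ "(r, c)"]) auto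
  qed
qed

section \<open>Extending homomorphisms with finite image\<close>

text \<open>
  Homomorphisms defined on a subring are total functions here; their values outside \<open>S\<close> are arbitrary.
\<close>

definition finite_image_hom :: "'a::comm_ring_1 set \<Rightarrow> ('a \<Rightarrow> 'b::comm_ring_1) \<Rightarrow> bool" where
  "finite_image_hom S \<phi> \<longleftrightarrow>
     unital_subring S \<and> \<phi> 1 = 1 \<and>
     (\<forall>x\<in>S. \<forall>y\<in>S. \<phi> (x + y) = \<phi> x + \<phi> y \<and> \<phi> (x * y) = \<phi> x * \<phi> y) \<and>
     finite (\<phi> ` S)"

lemma finite_image_homD:
  assumes "finite_image_hom S \<phi>"
  shows "unital_subring S" "\<phi> 1 = 1" "\<phi> 0 = 0" "finite (\<phi> ` S)"
    "x \<in> S \<Longrightarrow> y \<in> S \<Longrightarrow> \<phi> (x + y) = \<phi> x + \<phi> y"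
    "x \<in> S \<Longrightarrow> y \<in> S \<Longrightarrow> \<phi> (x * y) = \<phi> x * \<phi> y"
    "x \<in> S \<Longrightarrow> y \<in> S \<Longrightarrow> \<phi> (x - y) = \<phi> x - \<phi> y"
proof -
  show S: "unital_subring S" and "\<phi> 1 = 1" and "finite (\<phi> ` S)"
    using assms by (auto simp: finite_image_hom_def)
  show add: "\<phi> (x + y) = \<phi> x + \<phi> y" if "x \<in> S" "y \<in> S" for x y
    using assms that by (auto simp: finite_image_hom_def)
  show "x \<in> S \<Longrightarrow> y \<in> S \<Longrightarrow> \<phi> (x * y) = \<phi> x * \<phi> y"
    using assms by (auto simp: finite_image_hom_def)
  show "\<phi> 0 = 0"
    using add[of 0 0] unital_subringD(1)[OF S] by simp
  show "\<phi> (x - y) = \<phi> x - \<phi> y" if "x \<in> S" "y \<in> S"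
    using add[of "x - y" y] unital_subringD[OF S] that by simp
qed

lemma finite_image_hom_sum:
  assumes \<phi>: "finite_image_hom S \<phi>" and "\<And>i. i \<in> I \<Longrightarrow> f i \<in> S"
  shows "\<phi> (\<Sum>i\<in>I. f i) = (\<Sum>i\<in>I. \<phi> (f i))"
  using assms(2)
proof (induction I rule: infinite_finite_induct)
  case (insert i I)
  then have "(\<Sum>i\<in>I. f i) \<in> S"
    by (intro unital_subring_sum finite_image_homD(1)[OF \<phi>]) auto
  then show ?case using insert by (simp add: finite_image_homD(5)[OF \<phi>])
qed (simp_all add: finite_image_homD(3)[OF \<phi>])

lemma finite_image_hom_power:
  assumes \<phi>: "finite_image_hom S \<phi>" and "x \<in> S"
  shows "\<phi> (x ^ n) = \<phi> x ^ n"
proof (induction n)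
  case (Suc n)
  then show ?case
    using finite_image_homD(6)[OF \<phi> assms(2) unital_subring_power[OF finite_image_homD(1)[OF \<phi>] assms(2)]]
    by simp
qed (simp add: finite_image_homD(2)[OF \<phi>])

lemma unital_subring_image:
  assumes \<phi>: "finite_image_hom S \<phi>"
  shows "unital_subring (\<phi> ` S)"
  unfolding unital_subring_def
proof (intro conjI ballI)
  note S = unital_subringD[OF finite_image_homD(1)[OF \<phi>]]
  show "1 \<in> \<phi> ` S" using S(2) finite_image_homD(2)[OF \<phi>] by (metis image_eqI)
  fix u v assume "u \<in> \<phi> ` S" "v \<in> \<phi> ` S"
  then obtain x y where xy: "x \<in> S" "y \<in> S" "u = \<phi> x" "v = \<phi> y" by blast
  have "u - v = \<phi> (x - y)" "u * v = \<phi> (x * y)"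
    using xy finite_image_homD[OF \<phi>] by simp_all
  then show "u - v \<in> \<phi> ` S" "u * v \<in> \<phi> ` S"
    using S(5,6)[OF xy(1,2)] by auto
qed

lemma map_poly_hom:
  assumes \<phi>: "finite_image_hom S \<phi>" and f: "f \<in> polys_over S" and g: "g \<in> polys_over S"
  shows "map_poly \<phi> (f + g) = map_poly \<phi> f + map_poly \<phi> g"
    and "map_poly \<phi> (f * g) = map_poly \<phi> f * map_poly \<phi> g"
    and "map_poly \<phi> f \<in> polys_over (\<phi> ` S)"
proof -
  note c = coeff_map_poly[where f = \<phi>, OF finite_image_homD(3)[OF \<phi>]]
  note S = finite_image_homD(1)[OF \<phi>]
  show "map_poly \<phi> (f + g) = map_poly \<phi> f + map_poly \<phi> g"
    using f g by (intro poly_eqI) (simp add: c finite_image_homD(5)[OF \<phi>] coeff_polys_over)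
  show "map_poly \<phi> (f * g) = map_poly \<phi> f * map_poly \<phi> g"
  proof (rule poly_eqI)
    fix n
    have "\<phi> (\<Sum>i\<le>n. coeff f i * coeff g (n - i)) = (\<Sum>i\<le>n. \<phi> (coeff f i * coeff g (n - i)))"
      using f g by (intro finite_image_hom_sum[OF \<phi>] unital_subringD[OF S] coeff_polys_over)
    then show "coeff (map_poly \<phi> (f * g)) n = coeff (map_poly \<phi> f * map_poly \<phi> g) n"
      using f g by (simp add: c coeff_mult finite_image_homD(6)[OF \<phi>] coeff_polys_over)
  qed
  show "map_poly \<phi> f \<in> polys_over (\<phi> ` S)"
    using f by (auto simp: polys_over_def c)
qed

definition adjoin :: "'a::comm_ring_1 set \<Rightarrow> 'a \<Rightarrow> 'a set" where
  "adjoin S t = (\<lambda>f. poly f t) ` polys_over S"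

lemma unital_subring_adjoin:
  assumes "unital_subring S"
  shows "unital_subring (adjoin S t)"
  unfolding unital_subring_def
proof (intro conjI ballI)
  note cl = polys_over_closed[OF assms] and S = unital_subringD[OF assms]
  show "1 \<in> adjoin S t"
    unfolding adjoin_def by (rule image_eqI[of _ _ "[:1:]"]) (auto intro: cl S)
  fix u v assume "u \<in> adjoin S t" "v \<in> adjoin S t"
  then obtain f g where fg: "f \<in> polys_over S" "g \<in> polys_over S" "u = poly f t" "v = poly g t"
    unfolding adjoin_def by blast
  show "u - v \<in> adjoin S t"
    unfolding adjoin_def using fg by (intro image_eqI[of _ _ "f - g"] cl) auto
  show "u * v \<in> adjoin S t"
    unfolding adjoin_def using fg by (intro image_eqI[of _ _ "f * g"] cl) auto
qed

lemma subset_adjoin: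
  assumes "unital_subring S"
  shows "S \<subseteq> adjoin S t" "t \<in> adjoin S t"
proof -
  note cl = polys_over_closed[OF assms] and S = unital_subringD[OF assms]
  show "S \<subseteq> adjoin S t"
  proof
    fix s assume "s \<in> S"
    then show "s \<in> adjoin S t"
      unfolding adjoin_def by (intro image_eqI[of _ _ "[:s:]"] cl) auto
  qed
  show "t \<in> adjoin S t"
    unfolding adjoin_def by (rule image_eqI[of _ _ "[:0, 1:]"]) (auto intro: cl S)
qed

text \<open>
  An extension of \<open>\<phi>\<close> to \<open>S[t]\<close> may send \<open>t\<close> to \<open>\<tau>\<close> as soon as \<open>\<tau>\<close> satisfies the images of all
  relations of \<open>t\<close> over \<open>S\<close>: the value at \<open>f(t)\<close> is then independent of the choice of \<open>f\<close>. The
  image stays finite because \<open>\<tau>\<close> is algebraic over the finite ring \<open>\<phi>(S)\<close>.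
\<close>

lemma extend_hom_by_value:
  fixes \<phi> :: "'a::comm_ring_1 \<Rightarrow> 'l::field"
  assumes \<phi>: "finite_image_hom S \<phi>"
    and rel: "\<And>f. f \<in> polys_over S \<Longrightarrow> poly f t = 0 \<Longrightarrow> poly (map_poly \<phi> f) \<tau> = 0"
    and p: "p \<in> polys_over (\<phi> ` S)" "p \<noteq> 0" "poly p \<tau> = 0"
  obtains \<psi> where "finite_image_hom (adjoin S t) \<psi>"
    "\<And>f. f \<in> polys_over S \<Longrightarrow> \<psi> (poly f t) = poly (map_poly \<phi> f) \<tau>"
proof -
  note S = finite_image_homD(1)[OF \<phi>]
  note cl = polys_over_closed[OF S]
  define \<psi> where
    "\<psi> z = poly (map_poly \<phi> (SOME f. f \<in> polys_over S \<and> poly f t = z)) \<tau>" for z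
  have eval: "\<psi> (poly f t) = poly (map_poly \<phi> f) \<tau>" if f: "f \<in> polys_over S" for f
  proof -
    define g where "g = (SOME g. g \<in> polys_over S \<and> poly g t = poly f t)"
    have g: "g \<in> polys_over S" "poly g t = poly f t"
      using someI[of "\<lambda>g. g \<in> polys_over S \<and> poly g t = poly f t" f] f unfolding g_def by auto
    have "g = (g - f) + f" by simp
    then have "map_poly \<phi> g = map_poly \<phi> (g - f) + map_poly \<phi> f"
      using map_poly_hom(1)[OF \<phi> cl(6)[OF g(1) f] f] by simp
    moreover have "poly (map_poly \<phi> (g - f)) \<tau> = 0"
      using g f by (intro rel cl) auto
    ultimately show ?thesis unfolding \<psi>_def g_def[symmetric] by simp
  qed
  have "finite_image_hom (adjoin S t) \<psi>"
    unfolding finite_image_hom_def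
  proof (intro conjI ballI)
    show "unital_subring (adjoin S t)" by (rule unital_subring_adjoin[OF S])
    have "[:1:] \<in> polys_over S" by (intro cl unital_subringD[OF S])
    from eval[OF this] show "\<psi> 1 = 1"
      by (simp add: map_poly_pCons finite_image_homD[OF \<phi>])
    fix u v assume "u \<in> adjoin S t" "v \<in> adjoin S t"
    then obtain f g where fg: "f \<in> polys_over S" "g \<in> polys_over S" "u = poly f t" "v = poly g t"
      unfolding adjoin_def by blast
    show "\<psi> (u + v) = \<psi> u + \<psi> v"
      using eval[OF cl(5)[OF fg(1,2)]] fg by (simp add: eval map_poly_hom[OF \<phi> fg(1,2)])
    show "\<psi> (u * v) = \<psi> u * \<psi> v"
      using eval[OF cl(7)[OF fg(1,2)]] fg by (simp add: eval map_poly_hom[OF \<phi> fg(1,2)])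
  next
    have "\<psi> ` adjoin S t \<subseteq> (\<lambda>f. poly f \<tau>) ` polys_over (\<phi> ` S)"
      unfolding adjoin_def using eval map_poly_hom(3)[OF \<phi>] by fastforce
    then show "finite (\<psi> ` adjoin S t)"
      using finite_values_at_root[OF unital_subring_image[OF \<phi>] finite_image_homD(4)[OF \<phi>] p]
      by (rule finite_subset)
  qed
  then show ?thesis using eval that by blast
qed

text \<open>
  A transcendental \<open>t\<close> may be sent anywhere. The value \<open>\<tau>\<close> has to be algebraic over \<open>\<phi>(S)\<close> and to
  avoid the roots of the image \<open>G\<close> of \<open>g\<close>; any root of \<open>X G - 1\<close> does both.
\<close>

lemma extend_hom_transcendental:
  fixes S :: "'a::idom set" and \<phi> :: "'a \<Rightarrow> 'l::alg_closed_field"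
  assumes \<phi>: "finite_image_hom S \<phi>"
    and tr: "\<And>f. f \<in> polys_over S \<Longrightarrow> poly f t = 0 \<Longrightarrow> f = 0"
    and g: "g \<in> polys_over S" "\<phi> (lead_coeff g) \<noteq> 0"
  shows "\<exists>\<psi> :: 'a \<Rightarrow> 'l. finite_image_hom (adjoin S t) \<psi> \<and> \<psi> (poly g t) \<noteq> 0"
proof -
  define G where "G = map_poly \<phi> g"
  have "coeff G (degree g) \<noteq> 0"
    using g by (simp add: G_def coeff_map_poly finite_image_homD(3)[OF \<phi>])
  then have "G \<noteq> 0" by auto
  then obtain \<tau> where \<tau>: "poly (pCons (- 1) G) \<tau> = 0"
    using alg_closed_imp_poly_has_root[of "pCons (- 1) G"] by auto
  have P: "pCons (- 1) G \<in> polys_over (\<phi> ` S)" "pCons (- 1) G \<noteq> 0"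
    using map_poly_hom(3)[OF \<phi> g(1) g(1)] unital_subringD[OF unital_subring_image[OF \<phi>]]
    by (auto simp: G_def intro: polys_over_closed(2)[OF unital_subring_image[OF \<phi>]])
  have rel: "poly (map_poly \<phi> f) \<tau> = 0" if "f \<in> polys_over S" "poly f t = 0" for f
    using tr[OF that] by simp
  obtain \<psi> where \<psi>: "finite_image_hom (adjoin S t) \<psi>"
    "\<And>f. f \<in> polys_over S \<Longrightarrow> \<psi> (poly f t) = poly (map_poly \<phi> f) \<tau>"
    using extend_hom_by_value[OF \<phi> rel P \<tau>] by blast
  have "\<psi> (poly g t) \<noteq> 0"
    using \<tau> \<psi>(2)[OF g(1)] by (auto simp: G_def)
  then show ?thesis using \<psi>(1) by blast
qed

text \<open>
  The polynomial \<open>p\<close> is a minimal polynomial of \<open>t\<close>, up to a denominator. If its leading coefficient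
  survives, its image \<open>P\<close> is nonconstant and \<open>t\<close> may be sent to any root of \<open>P\<close>: by minimality every
  relation \<open>f\<close> of \<open>t\<close> has a multiple \<open>c f\<close>, with \<open>\<phi> c \<noteq> 0\<close>, that is divisible by \<open>p\<close>.
\<close>

lemma extend_hom_algebraic:
  fixes S :: "'a::idom set" and \<phi> :: "'a \<Rightarrow> 'l::alg_closed_field"
  assumes \<phi>: "finite_image_hom S \<phi>"
    and p: "p \<in> polys_over S" "p \<noteq> 0" "poly p t = 0"
    and min: "\<And>f. f \<in> polys_over S \<Longrightarrow> poly f t = 0 \<Longrightarrow> f \<noteq> 0 \<Longrightarrow> degree p \<le> degree f"
    and lc: "\<phi> (lead_coeff p) \<noteq> 0"
  obtains \<psi> :: "'a \<Rightarrow> 'l" where "finite_image_hom (adjoin S t) \<psi>" "\<And>s. s \<in> S \<Longrightarrow> \<psi> s = \<phi> s"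
proof -
  note S = finite_image_homD(1)[OF \<phi>]
  note cl = polys_over_closed[OF S]
  note mp = coeff_map_poly[where f = \<phi>, OF finite_image_homD(3)[OF \<phi>]]
  define P where "P = map_poly \<phi> p"
  have "degree p > 0"
    using p by (metis degree_eq_zeroE gr0I poly_const_conv poly_0 pCons_0_0)
  moreover have "coeff P (degree p) \<noteq> 0"
    using lc by (simp add: P_def mp)
  ultimately have P: "degree P > 0"
    using le_degree[of P "degree p"] by linarith
  then obtain \<tau> where \<tau>: "poly P \<tau> = 0"
    using alg_closed_imp_poly_has_root[of P] by auto
  have rel: "poly (map_poly \<phi> f) \<tau> = 0" if f: "f \<in> polys_over S" "poly f t = 0" for f
  proof -
    obtain k q r where kqr: "q \<in> polys_over S" "r \<in> polys_over S"
      "smult (lead_coeff p ^ k) f = q * p + r" "r = 0 \<or> degree r < degree p"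
      using pseudo_division_over[OF S p(1,2) f(1)] by metis
    have "poly r t = 0"
      using arg_cong[OF kqr(3), of "\<lambda>h. poly h t"] f p by simp
    then have "r = 0"
      using kqr min[of r] by fastforce
    define c where "c = lead_coeff p ^ k"
    have c: "c \<in> S" "\<phi> c \<noteq> 0"
      using p lc S by (auto simp: c_def finite_image_hom_power[OF \<phi>] coeff_polys_over
          intro: unital_subring_power)
    have "[:c:] * f = q * p"
      using kqr(3) \<open>r = 0\<close> by (simp add: c_def)
    then have "map_poly \<phi> [:c:] * map_poly \<phi> f = map_poly \<phi> q * P"
      unfolding P_def using c f p kqr cl
      by (simp flip: map_poly_hom(2)[OF \<phi>])
    from arg_cong[OF this, of "\<lambda>h. poly h \<tau>"] show ?thesis
      using \<tau> c by (simp add: map_poly_pCons finite_image_homD[OF \<phi>])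
  qed
  have PS: "P \<in> polys_over (\<phi> ` S)" "P \<noteq> 0"
    using P map_poly_hom(3)[OF \<phi> p(1) p(1)] by (auto simp: P_def)
  obtain \<psi> where \<psi>: "finite_image_hom (adjoin S t) \<psi>"
    "\<And>f. f \<in> polys_over S \<Longrightarrow> \<psi> (poly f t) = poly (map_poly \<phi> f) \<tau>"
    using extend_hom_by_value[OF \<phi> rel PS \<tau>] by blast
  have "\<psi> s = \<phi> s" if "s \<in> S" for s
    using \<psi>(2)[of "[:s:]"] that cl by (simp add: map_poly_pCons finite_image_homD(3)[OF \<phi>])
  then show ?thesis using \<psi>(1) that by blast
qed

text \<open>
  Among the polynomials over \<open>S\<close> whose value at \<open>t\<close> is a nonzero multiple of \<open>x\<close>, one of least
  degree, \<open>r\<close>, is constant: this is the Euclidean algorithm for \<open>p\<close> and \<open>r\<close>, which are coprime over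
  the fraction field because \<open>p\<close> is irreducible there. A remainder on division of \<open>p\<close> by \<open>r\<close> that
  did not vanish at \<open>t\<close> would be a smaller candidate, so \<open>r\<close> divides \<open>p\<close> up to a scalar; the
  cofactor vanishes at \<open>t\<close> and thus has full degree.
\<close>

lemma algebraic_multiple_in_base:
  fixes S :: "'a::idom set"
  assumes S: "unital_subring S"
    and p: "p \<in> polys_over S" "p \<noteq> 0" "poly p t = 0"
    and min: "\<And>f. f \<in> polys_over S \<Longrightarrow> poly f t = 0 \<Longrightarrow> f \<noteq> 0 \<Longrightarrow> degree p \<le> degree f"
    and x: "x \<in> adjoin S t" "x \<noteq> 0"
  obtains d v where "d \<in> S" "d \<noteq> 0" "v \<in> adjoin S t" "d = v * x"
proof -
  note A = unital_subringD[OF unital_subring_adjoin[OF S, of t]]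
  define Q where "Q r \<longleftrightarrow> r \<in> polys_over S \<and> poly r t \<noteq> 0 \<and> (\<exists>v\<in>adjoin S t. poly r t = v * x)"
    for r
  obtain g where g: "g \<in> polys_over S" "x = poly g t"
    using x(1) unfolding adjoin_def by blast
  have "Q g"
    unfolding Q_def using g x(2) A(2) by (auto intro!: bexI[of _ 1])
  then obtain r where r: "Q r" and rmin: "\<And>r'. Q r' \<Longrightarrow> degree r \<le> degree r'"
    using ex_has_least_nat[of Q g degree] by blast
  from r obtain v where rS: "r \<in> polys_over S" and r0: "poly r t \<noteq> 0"
    and v: "v \<in> adjoin S t" "poly r t = v * x"
    unfolding Q_def by blast
  have "r \<noteq> 0" using r0 by auto
  then obtain k q s where kqs: "q \<in> polys_over S" "s \<in> polys_over S"
    "smult (lead_coeff r ^ k) p = q * r + s" "s = 0 \<or> degree s < degree r"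
    using pseudo_division_over[OF S rS _ p(1)] by metis
  have ev: "poly q t * poly r t + poly s t = 0"
    using arg_cong[OF kqs(3), of "\<lambda>h. poly h t"] p(3) by simp
  have qA: "poly q t \<in> adjoin S t" using kqs(1) unfolding adjoin_def by blast
  have "poly s t = (- poly q t * v) * x"
    using ev v(2) by (simp add: eq_neg_iff_add_eq_0 algebra_simps)
  moreover have "- poly q t * v \<in> adjoin S t" by (rule A(6)[OF A(3)[OF qA] v(1)])
  ultimately have "Q s" if "poly s t \<noteq> 0"
    unfolding Q_def using kqs(2) that by blast
  then have st: "poly s t = 0"
    using kqs(4) rmin[of s] by fastforce
  then have qt: "poly q t = 0" using ev r0 by simp
  have "degree r = 0"
  proof (cases "degree p < degree r")
    \<comment> \<open>as \<open>p\<close> vanishes at \<open>t\<close>, the remainder of \<open>r\<close> modulo \<open>p\<close> is a candidate smaller than \<open>r\<close>\<close>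
    case True
    obtain k' q' s' where kqs': "q' \<in> polys_over S" "s' \<in> polys_over S"
      "smult (lead_coeff p ^ k') r = q' * p + s'" "s' = 0 \<or> degree s' < degree p"
      using pseudo_division_over[OF S p(1,2) rS] by metis
    have e: "poly s' t = (lead_coeff p ^ k' * v) * x"
      using arg_cong[OF kqs'(3), of "\<lambda>h. poly h t"] p(3) v(2) by (simp add: mult.assoc)
    have "lead_coeff p ^ k' \<in> adjoin S t"
      using subset_adjoin(1)[OF S] unital_subring_power[OF S coeff_polys_over[OF p(1)]] by (rule subsetD)
    then have "lead_coeff p ^ k' * v \<in> adjoin S t" using v(1) by (rule A(6))
    moreover have "poly s' t \<noteq> 0"
      unfolding e using p(2) v(2) r0 by simp
    ultimately have "Q s'" unfolding Q_def using kqs'(2) e by blast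
    then show ?thesis using rmin[of s'] kqs'(4) True \<open>poly s' t \<noteq> 0\<close> by fastforce
  next
    case False
    have "s = 0"
      using min[OF kqs(2) st] kqs(4) False by fastforce
    then have e: "smult (lead_coeff r ^ k) p = q * r" using kqs(3) by simp
    then have "q \<noteq> 0" using p(2) \<open>r \<noteq> 0\<close> by auto
    then have "degree p \<le> degree q" using min kqs(1) qt by blast
    moreover have "degree p = degree q + degree r"
      using arg_cong[OF e, of degree] \<open>q \<noteq> 0\<close> \<open>r \<noteq> 0\<close> by (simp add: degree_mult_eq)
    ultimately show ?thesis by simp
  qed
  then obtain d where d: "r = [:d:]" by (rule degree_eq_zeroE)
  show ?thesis
  proof (rule that)
    show "d \<in> S" using coeff_polys_over[OF rS, of 0] d by simp
    show "d \<noteq> 0" using \<open>r \<noteq> 0\<close> d by simp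
    show "v \<in> adjoin S t" by fact
    show "d = v * x" using v(2) d by simp
  qed
qed

text \<open>
  For transcendental \<open>t\<close> and \<open>x = g(t)\<close> the leading coefficient of \<open>g\<close> serves as \<open>y\<close>. For algebraic
  \<open>t\<close> the factor \<open>lead_coeff p\<close> of \<open>y\<close> makes the extension possible, and the factor \<open>d\<close>, a multiple
  of \<open>x\<close>, prevents it from killing \<open>x\<close>.
\<close>

lemma nonvanishing_extension:
  fixes S :: "'a::idom set"
  assumes S: "unital_subring S" and x: "x \<in> adjoin S t" "x \<noteq> 0"
  obtains y where "y \<in> S" "y \<noteq> 0"
    "\<And>\<phi> :: 'a \<Rightarrow> 'l::alg_closed_field. finite_image_hom S \<phi> \<Longrightarrow> \<phi> y \<noteq> 0 \<Longrightarrow>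
       \<exists>\<psi> :: 'a \<Rightarrow> 'l. finite_image_hom (adjoin S t) \<psi> \<and> \<psi> x \<noteq> 0"
proof (cases "\<exists>f. f \<in> polys_over S \<and> poly f t = 0 \<and> f \<noteq> 0")
  case False
  obtain g where g: "g \<in> polys_over S" "x = poly g t"
    using x(1) unfolding adjoin_def by blast
  show ?thesis
  proof (rule that[of "lead_coeff g"])
    show "lead_coeff g \<in> S" using g(1) by (rule coeff_polys_over)
    show "lead_coeff g \<noteq> 0" using g x(2) by auto
    fix \<phi> :: "'a \<Rightarrow> 'l" assume "finite_image_hom S \<phi>" "\<phi> (lead_coeff g) \<noteq> 0"
    then show "\<exists>\<psi> :: 'a \<Rightarrow> 'l. finite_image_hom (adjoin S t) \<psi> \<and> \<psi> x \<noteq> 0"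
      unfolding g(2) using False g(1) by (intro extend_hom_transcendental) auto
  qed
next
  case True
  then obtain p where p: "p \<in> polys_over S" "p \<noteq> 0" "poly p t = 0"
    and min: "\<And>f. f \<in> polys_over S \<Longrightarrow> poly f t = 0 \<Longrightarrow> f \<noteq> 0 \<Longrightarrow> degree p \<le> degree f"
    using ex_has_least_nat[of "\<lambda>f. f \<in> polys_over S \<and> poly f t = 0 \<and> f \<noteq> 0" _ degree] by blast
  obtain d v where d: "d \<in> S" "d \<noteq> 0" "v \<in> adjoin S t" "d = v * x"
    using algebraic_multiple_in_base[OF S p min x] by blast
  have lcS: "lead_coeff p \<in> S" using p(1) by (rule coeff_polys_over)
  show ?thesis
  proof (rule that[of "lead_coeff p * d"])
    show "lead_coeff p * d \<in> S" using lcS d by (intro unital_subringD[OF S])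
    show "lead_coeff p * d \<noteq> 0" using p d by simp
    fix \<phi> :: "'a \<Rightarrow> 'l" assume \<phi>: "finite_image_hom S \<phi>" and "\<phi> (lead_coeff p * d) \<noteq> 0"
    then have nz: "\<phi> (lead_coeff p) \<noteq> 0" "\<phi> d \<noteq> 0"
      using lcS d by (auto simp: finite_image_homD(6)[OF \<phi>])
    obtain \<psi> :: "'a \<Rightarrow> 'l" where \<psi>: "finite_image_hom (adjoin S t) \<psi>" "\<And>s. s \<in> S \<Longrightarrow> \<psi> s = \<phi> s"
      using extend_hom_algebraic[OF \<phi> p min nz(1)] by blast
    have "\<psi> v * \<psi> x = \<phi> d"
      using \<psi>(2)[OF d(1)] finite_image_homD(6)[OF \<psi>(1) d(3) x(1)] d(4) by simp
    then have "\<psi> x \<noteq> 0" using nz(2) by auto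
    then show "\<exists>\<psi> :: 'a \<Rightarrow> 'l. finite_image_hom (adjoin S t) \<psi> \<and> \<psi> x \<noteq> 0"
      using \<psi>(1) by blast
  qed
qed

lemma finite_prime_subring:
  assumes "CHAR('k::field) > 0"
  shows "unital_subring (range (of_int :: int \<Rightarrow> 'k))" "finite (range (of_int :: int \<Rightarrow> 'k))"
proof -
  show "unital_subring (range (of_int :: int \<Rightarrow> 'k))"
    unfolding unital_subring_def
  proof (intro conjI ballI)
    show "1 \<in> range (of_int :: int \<Rightarrow> 'k)" by (metis of_int_1 rangeI)
    fix x y :: 'k assume "x \<in> range of_int" "y \<in> range of_int"
    then obtain m n where "x = of_int m" "y = of_int n" by blast
    then show "x - y \<in> range of_int" "x * y \<in> range of_int"
      by (metis of_int_diff rangeI, metis of_int_mult rangeI)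
  qed
  have "range (of_int :: int \<Rightarrow> 'k) \<subseteq> of_int ` {0..<int CHAR('k)}"
  proof
    fix z :: 'k assume "z \<in> range of_int"
    then obtain n where n: "z = of_int n" by blast
    have "of_int (n - n mod int CHAR('k)) = (0 :: 'k)"
      by (simp only: of_int_eq_0_iff_char_dvd dvd_minus_mod)
    then have "z = of_int (n mod int CHAR('k))" using n by simp
    then show "z \<in> of_int ` {0..<int CHAR('k)}" using assms by auto
  qed
  then show "finite (range (of_int :: int \<Rightarrow> 'k))" by (rule finite_subset) simp
qed

text \<open>
  This is the only place where positive characteristic enters: the induction over the generators
  starts at the prime subring, on which the embedding into the algebraic closure is injective and
  has finite image.
\<close>

lemma obtain_residually_finite_subring:
  assumes char: "CHAR('k::field) > 0" and Y: "finite (Y :: 'k set)"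
  obtains S where "Y \<subseteq> S" "unital_subring S"
    "\<And>x. x \<in> S \<Longrightarrow> x \<noteq> 0 \<Longrightarrow> \<exists>\<phi> :: 'k \<Rightarrow> 'k alg_closure. finite_image_hom S \<phi> \<and> \<phi> x \<noteq> 0"
proof -
  have "\<exists>S. Y \<subseteq> S \<and> unital_subring S \<and>
      (\<forall>x\<in>S. x \<noteq> 0 \<longrightarrow> (\<exists>\<phi> :: 'k \<Rightarrow> 'k alg_closure. finite_image_hom S \<phi> \<and> \<phi> x \<noteq> 0))"
    using Y
  proof (induction Y rule: finite_induct)
    case empty
    note R = finite_prime_subring[OF char]
    have "finite_image_hom (range of_int) (to_ac :: 'k \<Rightarrow> 'k alg_closure)"
      using R by (auto simp: finite_image_hom_def)
    moreover have "to_ac x \<noteq> 0" if "x \<noteq> 0" for x :: 'k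
      using that by simp
    ultimately show ?case using R(1)
      by (intro exI[of _ "range of_int"]) blast
  next
    case (insert t Y)
    then obtain S where S: "Y \<subseteq> S" "unital_subring S"
      and sep: "\<And>x. x \<in> S \<Longrightarrow> x \<noteq> 0 \<Longrightarrow>
        \<exists>\<phi> :: 'k \<Rightarrow> 'k alg_closure. finite_image_hom S \<phi> \<and> \<phi> x \<noteq> 0"
      by blast
    have "\<exists>\<psi> :: 'k \<Rightarrow> 'k alg_closure. finite_image_hom (adjoin S t) \<psi> \<and> \<psi> x \<noteq> 0"
      if x: "x \<in> adjoin S t" "x \<noteq> 0" for x
      using nonvanishing_extension[OF S(2) x, where ?'l = "'k alg_closure"] sep by metis
    moreover have "insert t Y \<subseteq> adjoin S t"
      using S subset_adjoin by blast
    ultimately show ?case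
      using unital_subring_adjoin[OF S(2)] by blast
  qed
  then show ?thesis using that by blast
qed

section \<open>Cellular automata from group ring elements\<close>

text \<open>
  The group element is applied on the right because shifts act on the left, so the two commute.
\<close>

definition linear_automaton :: "('g::group_add \<Rightarrow>\<^sub>0 'r::ring_1) \<Rightarrow> ('g \<Rightarrow> 'r) \<Rightarrow> 'g \<Rightarrow> 'r" where
  "linear_automaton a c x = (\<Sum>g\<in>Poly_Mapping.keys a. Poly_Mapping.lookup a g * c (x + g))"

lemma linear_automaton_superset:
  assumes "finite M" "Poly_Mapping.keys a \<subseteq> M"
  shows "linear_automaton a c x = (\<Sum>g\<in>M. Poly_Mapping.lookup a g * c (x + g))"
  unfolding linear_automaton_def using assms
  by (intro sum.mono_neutral_left) (auto simp: in_keys_iff)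

lemma lookup_mult_sum:
  fixes a b :: "'g::group_add \<Rightarrow>\<^sub>0 'r::semiring_0"
  assumes M: "finite M" "Poly_Mapping.keys a \<subseteq> M"
  shows "Poly_Mapping.lookup (a * b) k =
    (\<Sum>g\<in>M. Poly_Mapping.lookup a g * Poly_Mapping.lookup b (- g + k))"
proof -
  have "k = g + q \<longleftrightarrow> q = - g + k" for g q :: 'g
    by (auto simp flip: add.assoc)
  then have "Poly_Mapping.lookup (a * b) k =
      (\<Sum>g. Poly_Mapping.lookup a g * Poly_Mapping.lookup b (- g + k))"
    by (simp add: lookup_mult)
  also have "\<dots> = (\<Sum>g\<in>M. Poly_Mapping.lookup a g * Poly_Mapping.lookup b (- g + k))"
    using M by (intro Sum_any.expand_superset) (auto, metis in_keys_iff mult_zero_left subsetD)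
  finally show ?thesis .
qed

lemma linear_automaton_mult: "linear_automaton a (linear_automaton b c) = linear_automaton (a * b) c"
proof
  fix x
  let ?a = "Poly_Mapping.lookup a" and ?b = "Poly_Mapping.lookup b"
  let ?A = "Poly_Mapping.keys a" and ?B = "Poly_Mapping.keys b"
  define M where "M = (\<lambda>(g, h). g + h) ` (?A \<times> ?B)"
  have M: "finite M" unfolding M_def by simp
  have K: "Poly_Mapping.keys (a * b) \<subseteq> M"
    using keys_mult[of a b] unfolding M_def by auto
  have inner: "(\<Sum>k\<in>M. ?b (- g + k) * c (x + k)) = linear_automaton b c (x + g)" if g: "g \<in> ?A" for g
  proof -
    have "linear_automaton b c (x + g) = (\<Sum>h\<in>?B. ?b h * c (x + (g + h)))"
      by (simp add: linear_automaton_def add.assoc)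
    also have "\<dots> = (\<Sum>k\<in>(+) g ` ?B. ?b (- g + k) * c (x + k))"
      by (subst sum.reindex) (auto simp flip: add.assoc)
    also have "\<dots> = (\<Sum>k\<in>M. ?b (- g + k) * c (x + k))"
    proof (rule sum.mono_neutral_left[OF M])
      show "(+) g ` ?B \<subseteq> M" using g unfolding M_def by force
      show "\<forall>k\<in>M - (+) g ` ?B. ?b (- g + k) * c (x + k) = 0"
      proof
        fix k assume k: "k \<in> M - (+) g ` ?B"
        have "k = g + (- g + k)" by (simp flip: add.assoc)
        then have "- g + k \<notin> ?B" using k by blast
        then show "?b (- g + k) * c (x + k) = 0" by (simp add: in_keys_iff)
      qed
    qed
    finally show ?thesis by simp
  qed
  have "linear_automaton (a * b) c x = (\<Sum>k\<in>M. (\<Sum>g\<in>?A. ?a g * ?b (- g + k)) * c (x + k))"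
    by (simp add: linear_automaton_superset[OF M K] lookup_mult_sum[of ?A])
  also have "\<dots> = (\<Sum>k\<in>M. \<Sum>g\<in>?A. ?a g * (?b (- g + k) * c (x + k)))"
    by (simp add: sum_distrib_right mult.assoc)
  also have "\<dots> = (\<Sum>g\<in>?A. ?a g * (\<Sum>k\<in>M. ?b (- g + k) * c (x + k)))"
    by (subst sum.swap) (simp add: sum_distrib_left)
  also have "\<dots> = linear_automaton a (linear_automaton b c) x"
    by (simp add: inner linear_automaton_def[of a])
  finally show "linear_automaton a (linear_automaton b c) x = linear_automaton (a * b) c x" by simp
qed

lemma linear_automaton_one: "linear_automaton 1 c = c"
  by (rule ext) (simp add: linear_automaton_superset[of "{0}"] lookup_one in_keys_iff subset_iff when_def)

text \<open>
  Point masses recover the coefficients, so \<open>a\<close> is determined by its action on finitely supported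
  configurations.
\<close>

lemma linear_automaton_delta: "linear_automaton a (\<lambda>x. if x = k then 1 else 0) 0 = Poly_Mapping.lookup a k"
  by (simp add: linear_automaton_superset[of "insert k (Poly_Mapping.keys a)"] subset_insertI if_distrib
      sum.delta cong: if_cong)

text \<open>
  Additivity in the form needed to correct \<open>c\<close> by \<open>T\<^sub>b (e - T\<^sub>a c)\<close>.
\<close>

lemma linear_automaton_add_diff: "linear_automaton a (\<lambda>x. c x + (d x - e x)) x = linear_automaton a c x + (linear_automaton a d x - linear_automaton a e x)"
  by (simp add: linear_automaton_def algebra_simps sum.distrib sum_subtractf)

lemma finite_support_linear_automaton:
  assumes "finite {x. c x \<noteq> 0}"
  shows "finite {x. linear_automaton a c x \<noteq> 0}"
proof (rule finite_subset)
  show "{x. linear_automaton a c x \<noteq> 0} \<subseteq> (\<lambda>(g, y). y - g) ` (Poly_Mapping.keys a \<times> {y. c y \<noteq> 0})"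
  proof
    fix x assume "x \<in> {x. linear_automaton a c x \<noteq> 0}"
    then obtain g where "g \<in> Poly_Mapping.keys a" "Poly_Mapping.lookup a g * c (x + g) \<noteq> 0"
      unfolding linear_automaton_def using sum.not_neutral_contains_not_neutral by blast
    then show "x \<in> (\<lambda>(g, y). y - g) ` (Poly_Mapping.keys a \<times> {y. c y \<noteq> 0})"
      by (intro image_eqI[of _ _ "(g, x + g)"]) auto
  qed
qed (use assms in auto)

lemma linear_automaton_full_shift:
  assumes "unital_subring A" "\<And>g. Poly_Mapping.lookup a g \<in> A" "c \<in> full_shift A"
  shows "linear_automaton a c \<in> full_shift A"
  using assms unfolding linear_automaton_def
  by (auto simp: PiE_iff intro!: unital_subring_sum unital_subringD)

text \<open>
  The easy half of the Curtis--Hedlund--Lyndon theorem: fixing the cells in the window \<open>M\<close> defines an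
  open set on which \<open>F\<close> is constant.
\<close>

lemma continuous_map_finite_window:
  fixes F :: "('g::group_add \<Rightarrow> 'a) \<Rightarrow> 'b"
  assumes M: "finite M" and F: "\<And>c. c \<in> full_shift A \<Longrightarrow> F c \<in> B"
    and window: "\<And>c d. c \<in> full_shift A \<Longrightarrow> d \<in> full_shift A \<Longrightarrow> (\<And>i. i \<in> M \<Longrightarrow> c i = d i) \<Longrightarrow> F c = F d"
  shows "continuous_map (shift_topology A) (discrete_topology B) F"
  unfolding continuous_map_def
proof (intro conjI allI impI)
  show "F \<in> topspace (shift_topology A) \<rightarrow> topspace (discrete_topology B)"
    using F by simp
  fix U
  show "openin (shift_topology A) {c \<in> topspace (shift_topology A). F c \<in> U}"
  proof (subst openin_subopen, intro ballI)
    fix c assume c: "c \<in> {c \<in> topspace (shift_topology A). F c \<in> U}"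
    let ?X = "\<lambda>i. if i \<in> M then {c i} else A"
    have cA: "c i \<in> A" for i using c by (auto simp: PiE_iff)
    have "openin (shift_topology A) (\<Pi>\<^sub>E i\<in>UNIV. ?X i)"
      unfolding shift_topology_def
      by (rule product_topology_basis) (use cA M in \<open>auto elim: rev_finite_subset\<close>)
    moreover have "c \<in> (\<Pi>\<^sub>E i\<in>UNIV. ?X i)" using cA by auto
    moreover have "(\<Pi>\<^sub>E i\<in>UNIV. ?X i) \<subseteq> {c \<in> topspace (shift_topology A). F c \<in> U}"
    proof
      fix d assume d: "d \<in> (\<Pi>\<^sub>E i\<in>UNIV. ?X i)"
      then have di: "d i \<in> ?X i" for i by (auto simp: PiE_iff)
      have "d i \<in> A" for i using di[of i] cA by (auto split: if_splits)
      then have dA: "d \<in> full_shift A" by auto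
      have "d i = c i" if "i \<in> M" for i using di[of i] that by simp
      then have "F d = F c" using c by (intro window dA) auto
      then show "d \<in> {c \<in> topspace (shift_topology A). F c \<in> U}" using c dA by simp
    qed
    ultimately show "\<exists>T. openin (shift_topology A) T \<and> c \<in> T \<and>
        T \<subseteq> {c \<in> topspace (shift_topology A). F c \<in> U}"
      by blast
  qed
qed

lemma cellular_automaton_linear_automaton:
  assumes A: "unital_subring A" and a: "\<And>g. Poly_Mapping.lookup a g \<in> A"
  shows "cellular_automaton A (linear_automaton a)"
  unfolding cellular_automaton_def
proof (intro conjI allI ballI)
  have "continuous_map (shift_topology A) (discrete_topology A) (\<lambda>c. linear_automaton a c x)" for x
  proof (rule continuous_map_finite_window[of "(+) x ` Poly_Mapping.keys a"])
    show "linear_automaton a c x \<in> A" if "c \<in> full_shift A" for c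
      using linear_automaton_full_shift[OF A a that] by auto
  qed (auto simp: linear_automaton_def)
  then show "continuous_map (shift_topology A) (shift_topology A) (linear_automaton a)"
    unfolding shift_topology_def[of A] by (simp add: continuous_map_componentwise_UNIV)
  show "linear_automaton a (shift g c) = shift g (linear_automaton a c)" for g c
    by (simp add: linear_automaton_def shift_def add.assoc fun_eq_iff)
qed

text \<open>
  In both cases the aim is that \<open>T\<^sub>b \<circ> T\<^sub>a\<close> fixes the point masses. Surjunctivity is applied to
  \<open>T\<^sub>b\<close>, dual surjunctivity to \<open>T\<^sub>a\<close>.
\<close>

lemma directly_finite_over_finite_ring:
  fixes A :: "'r::ring_1 set" and a b :: "'g::group_add \<Rightarrow>\<^sub>0 'r"
  assumes G: "surjunctive TYPE('g) \<or> dual_surjunctive TYPE('g)"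
    and A: "unital_subring A" "finite A"
    and a: "\<And>g. Poly_Mapping.lookup a g \<in> A" and b: "\<And>g. Poly_Mapping.lookup b g \<in> A"
    and ab: "a * b = 1"
  shows "b * a = 1"
proof (rule poly_mapping_eqI)
  fix k
  note Ta = cellular_automaton_linear_automaton[OF A(1) a] and Tb = cellular_automaton_linear_automaton[OF A(1) b]
  note cla = linear_automaton_full_shift[OF A(1) a] and clb = linear_automaton_full_shift[OF A(1) b]
  note R = unital_subringD[OF A(1)]
  have inv: "linear_automaton a (linear_automaton b c) = c" for c
    by (simp add: linear_automaton_mult ab linear_automaton_one)
  define \<delta> :: "'g \<Rightarrow> 'r" where "\<delta> = (\<lambda>x. if x = k then 1 else 0)"
  have \<delta>: "\<delta> \<in> full_shift A" using R by (auto simp: \<delta>_def)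
  from G have "linear_automaton b (linear_automaton a \<delta>) = \<delta>"
  proof
    assume S: "surjunctive TYPE('g)"
    have "inj_on (linear_automaton b) (full_shift A)"
      by (rule inj_on_inverseI[of _ "linear_automaton a"]) (rule inv)
    then have "linear_automaton b ` full_shift A = full_shift A"
      by (rule surjunctiveD[OF S A(2) Tb])
    then obtain c where "\<delta> = linear_automaton b c" using \<delta> by blast
    then show ?thesis by (simp add: inv)
  next
    assume D: "dual_surjunctive TYPE('g)"
    have "post_surjective A (linear_automaton a)"
      unfolding post_surjective_def
    proof (intro ballI impI)
      fix c e assume c: "c \<in> full_shift A" and e: "e \<in> full_shift A" and ce: "linear_automaton a c \<sim>\<^sub>f e"
      define u where "u = (\<lambda>x. e x - linear_automaton a c x)"
      define c' where "c' = (\<lambda>x. c x + (linear_automaton b e x - linear_automaton b (linear_automaton a c) x))"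
      have c'A: "c' \<in> full_shift A"
        using c clb[OF e] clb[OF cla[OF c]] R by (auto simp: c'_def PiE_iff)
      have "linear_automaton b u x = linear_automaton b e x - linear_automaton b (linear_automaton a c) x" for x
        using linear_automaton_add_diff[of b "\<lambda>_. 0" e "linear_automaton a c" x] by (simp add: u_def linear_automaton_def)
      then have c'u: "c' = (\<lambda>x. c x + linear_automaton b u x)" by (simp add: c'_def)
      have "finite {x. u x \<noteq> 0}"
        using ce unfolding asymptotic_def u_def by (rule rev_finite_subset) auto
      then have "c' \<sim>\<^sub>f c"
        unfolding asymptotic_def c'u using finite_support_linear_automaton[of u b] by simp
      moreover have "linear_automaton a c' = e"
        by (rule ext) (simp add: c'_def linear_automaton_add_diff inv)
      ultimately show "\<exists>c'\<in>full_shift A. c' \<sim>\<^sub>f c \<and> linear_automaton a c' = e" using c'A by blast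
    qed
    then have pre: "pre_injective A (linear_automaton a)"
      by (rule dual_surjunctiveD[OF D A(2) Ta])
    have fin: "finite {x. \<delta> x \<noteq> 0}" by (simp add: \<delta>_def)
    have "linear_automaton b (linear_automaton a \<delta>) \<sim>\<^sub>f \<delta>"
      unfolding asymptotic_def
      by (rule finite_subset[of _ "{x. linear_automaton b (linear_automaton a \<delta>) x \<noteq> 0} \<union> {x. \<delta> x \<noteq> 0}"])
        (use finite_support_linear_automaton[OF finite_support_linear_automaton[OF fin]] fin in auto)
    then show ?thesis
      using pre clb[OF cla[OF \<delta>]] \<delta> inv[of "linear_automaton a \<delta>"] unfolding pre_injective_def by blast
  qed
  then have "linear_automaton (b * a) \<delta> 0 = linear_automaton 1 \<delta> 0"
    by (simp add: linear_automaton_mult linear_automaton_one)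
  then show "Poly_Mapping.lookup (b * a) k = Poly_Mapping.lookup 1 k"
    by (simp add: \<delta>_def linear_automaton_delta)
qed

section \<open>Group rings over fields of positive characteristic\<close>

lemma lookup_map_hom:
  "\<phi> 0 = 0 \<Longrightarrow> Poly_Mapping.lookup (Poly_Mapping.map \<phi> a) g = \<phi> (Poly_Mapping.lookup a g)"
  by (simp add: Poly_Mapping.map.rep_eq when_def)

lemma lookup_mult_in:
  fixes a b :: "'g::group_add \<Rightarrow>\<^sub>0 'r::ring_1"
  assumes "unital_subring S" "\<And>g. Poly_Mapping.lookup a g \<in> S" "\<And>g. Poly_Mapping.lookup b g \<in> S"
  shows "Poly_Mapping.lookup (a * b) g \<in> S"
  using assms
  by (auto simp: lookup_mult_sum[of "Poly_Mapping.keys a"] intro!: unital_subring_sum unital_subringD)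

lemma map_mult_hom:
  fixes a b :: "'g::group_add \<Rightarrow>\<^sub>0 'k::comm_ring_1"
  assumes \<phi>: "finite_image_hom S \<phi>"
    and a: "\<And>g. Poly_Mapping.lookup a g \<in> S" and b: "\<And>g. Poly_Mapping.lookup b g \<in> S"
  shows "Poly_Mapping.map \<phi> (a * b) = Poly_Mapping.map \<phi> a * Poly_Mapping.map \<phi> b"
proof (rule poly_mapping_eqI)
  fix k
  let ?A = "Poly_Mapping.keys a"
  note lm = lookup_map_hom[where \<phi> = \<phi>, OF finite_image_homD(3)[OF \<phi>]]
  have K: "Poly_Mapping.keys (Poly_Mapping.map \<phi> a) \<subseteq> ?A"
    by (auto simp: in_keys_iff lm finite_image_homD(3)[OF \<phi>])
  have "\<phi> (\<Sum>g\<in>?A. Poly_Mapping.lookup a g * Poly_Mapping.lookup b (- g + k)) =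
      (\<Sum>g\<in>?A. \<phi> (Poly_Mapping.lookup a g * Poly_Mapping.lookup b (- g + k)))"
    using a b by (intro finite_image_hom_sum[OF \<phi>] unital_subringD[OF finite_image_homD(1)[OF \<phi>]])
  then show "Poly_Mapping.lookup (Poly_Mapping.map \<phi> (a * b)) k =
      Poly_Mapping.lookup (Poly_Mapping.map \<phi> a * Poly_Mapping.map \<phi> b) k"
    using a b by (simp add: lm lookup_mult_sum[OF _ K] lookup_mult_sum[of ?A]
        finite_image_homD(6)[OF \<phi>])
qed

theorem theorem4p1:
  assumes "surjunctive TYPE('g::group_add) \<or> dual_surjunctive TYPE('g)"
    and "CHAR('k::field) > 0"
  shows "\<forall>a b :: 'g \<Rightarrow>\<^sub>0 'k. a * b = 1 \<longrightarrow> b * a = 1"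
proof (intro allI impI)
  fix a b :: "'g \<Rightarrow>\<^sub>0 'k"
  let ?l = Poly_Mapping.lookup
  assume ab: "a * b = 1"
  have "finite (range (?l a) \<union> range (?l b))"
  proof -
    have "range (?l c) \<subseteq> insert 0 (?l c ` Poly_Mapping.keys c)" for c :: "'g \<Rightarrow>\<^sub>0 'k"
      by (auto simp: in_keys_iff)
    then show ?thesis by (meson finite_UnI finite_imageI finite_insert finite_keys finite_subset)
  qed
  then obtain S where X: "range (?l a) \<union> range (?l b) \<subseteq> S" and S: "unital_subring S"
    and sep: "\<And>x. x \<in> S \<Longrightarrow> x \<noteq> 0 \<Longrightarrow>
      \<exists>\<phi> :: 'k \<Rightarrow> 'k alg_closure. finite_image_hom S \<phi> \<and> \<phi> x \<noteq> 0"
    using obtain_residually_finite_subring[OF assms(2)] by metis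
  have a: "?l a g \<in> S" and b: "?l b g \<in> S" for g using X by auto
  show "b * a = 1"
  proof (rule ccontr)
    assume "b * a \<noteq> 1"
    then obtain k where k: "?l (b * a) k \<noteq> ?l 1 k" by (metis poly_mapping_eqI)
    define x where "x = ?l (b * a) k - ?l 1 k"
    have one: "?l 1 k \<in> S"
      using unital_subringD(1,2)[OF S] by (simp add: lookup_one when_def)
    have ba: "?l (b * a) k \<in> S" by (rule lookup_mult_in[OF S b a])
    have "x \<in> S" "x \<noteq> 0" using one ba k unital_subringD(5)[OF S] by (auto simp: x_def)
    then obtain \<phi> :: "'k \<Rightarrow> 'k alg_closure" where \<phi>: "finite_image_hom S \<phi>" "\<phi> x \<noteq> 0"
      using sep by blast
    let ?m = "Poly_Mapping.map \<phi>"
    note lm = lookup_map_hom[where \<phi> = \<phi>, OF finite_image_homD(3)[OF \<phi>(1)]]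
    have map_one: "?m 1 = (1 :: 'g \<Rightarrow>\<^sub>0 'k alg_closure)"
      by (rule poly_mapping_eqI) (simp add: lm lookup_one when_def finite_image_homD[OF \<phi>(1)])
    have "?m b * ?m a = 1"
    proof (rule directly_finite_over_finite_ring[OF assms(1)])
      show "unital_subring (\<phi> ` S)" "finite (\<phi> ` S)"
        using unital_subring_image finite_image_homD(4) \<phi>(1) by blast+
      show "?l (?m a) g \<in> \<phi> ` S" "?l (?m b) g \<in> \<phi> ` S" for g
        using a b by (simp_all add: lm)
      show "?m a * ?m b = 1"
        using map_mult_hom[OF \<phi>(1) a b] ab map_one by simp
    qed
    then have "?m (b * a) = ?m 1"
      using map_mult_hom[OF \<phi>(1) b a] map_one by simp
    then have "\<phi> (?l (b * a) k) = \<phi> (?l 1 k)"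
      by (metis lm)
    then have "\<phi> x = 0"
      unfolding x_def by (simp add: finite_image_homD(7)[OF \<phi>(1) ba one])
    then show False using \<phi>(2) by simp
  qed
qed

end
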